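(* Let $\mathcal{F}$ be a hereditary family of graphs with $K_2\in\mathcal{F}$, and let $G$ be any graph with $G\notin\mathcal{F}$. Then for every $n\ge |G|$, $f(n,G|\mathcal{F})\ge \mathrm{ex}(n,D(G|\mathcal{F}))+2$.
   Context: All graphs are finite and simple; $|G|$ is the number of vertices of $G$. A family $\mathcal{F}$ of graphs (closed under isomorphism) is hereditary if $H\in\mathcal{F}$ and $H'\subset H$ (subgraph, not necessarily induced) imply $H'\in\mathcal{F}$; isolated vertices are disregarded for membership in $\mathcal{F}$ and edgeless graphs are trivially regarded as members. For a subgraph $D$ of $G$, $G-D$ denotes the graph on $V(G)$ obtained by deleting the edges of $D$. The $\mathcal{F}$-deck of $G$ is $D(G|\mathcal{F})=\{G-D : D\subset G,\ D\in\mathcal{F}\}$. For $n\ge |G|$, $f(n,G|\mathcal{F})$ is the smallest positive integer $k$ such that in every edge coloring of $K_n$ using at least $k$ colors there is a (not necessarily induced) copy of $G$ in which, for each color, the edges of that copy having that color form a member of $\mathcal{F}$. For a family $\mathcal{H}$ of graphs, $\mathrm{ex}(n,\mathcal{H})$ is the maximum number of edges in an $n$-vertex graph containing no subgraph isomorphic to any member of $\mathcal{H}$. *)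

theory Defs
  imports Main
begin

datatype 'a graph = Graph (verts: "'a set") (edges: "'a set set")

definition simple_graph :: "'a graph \<Rightarrow> bool" where
  "simple_graph G \<longleftrightarrow> finite (verts G) \<and> (\<forall>e\<in>edges G. e \<subseteq> verts G \<and> card e = 2)"

definition subgraph :: "'a graph \<Rightarrow> 'a graph \<Rightarrow> bool" where
  "subgraph H G \<longleftrightarrow> simple_graph H \<and> simple_graph G \<and> verts H \<subseteq> verts G \<and> edges H \<subseteq> edges G"

definition isomorphic :: "'a graph \<Rightarrow> 'b graph \<Rightarrow> bool" where
  "isomorphic G H \<longleftrightarrow> simple_graph G \<and> simple_graph H \<and>
     (\<exists>\<phi>. bij_betw \<phi> (verts G) (verts H) \<and> (\<lambda>e. \<phi> ` e) ` edges G = edges H)"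

definition complete_graph :: "nat \<Rightarrow> nat graph" where
  "complete_graph n = Graph {..<n} {e. e \<subseteq> {..<n} \<and> card e = 2}"

text \<open>Every finite graph has an isomorphic copy on natural numbers, so isomorphism-closed
  families of finite graphs are represented by isomorphism-closed sets of graphs on naturals.
  The last two conjuncts are the conventions that isolated vertices do not affect
  membership and that edgeless graphs are always members.\<close>

definition graph_family :: "nat graph set \<Rightarrow> bool" where
  "graph_family F \<longleftrightarrow>
     (\<forall>H\<in>F. simple_graph H) \<and>
     (\<forall>H H'. H \<in> F \<longrightarrow> isomorphic H H' \<longrightarrow> H' \<in> F) \<and>
     (\<forall>H H'. simple_graph H \<longrightarrow> simple_graph H' \<longrightarrow> edges H = edges H' \<longrightarrow> H \<in> F \<longrightarrow> H' \<in> F) \<and>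
     (\<forall>H. simple_graph H \<longrightarrow> edges H = {} \<longrightarrow> H \<in> F)"

definition hereditary :: "nat graph set \<Rightarrow> bool" where
  "hereditary F \<longleftrightarrow> graph_family F \<and> (\<forall>H H'. H \<in> F \<longrightarrow> subgraph H' H \<longrightarrow> H' \<in> F)"

definition delete_edges :: "'a graph \<Rightarrow> 'a graph \<Rightarrow> 'a graph" where
  "delete_edges G D = Graph (verts G) (edges G - edges D)"

definition deck :: "nat graph \<Rightarrow> nat graph set \<Rightarrow> nat graph set" where
  "deck G F = {delete_edges G D | D. subgraph D G \<and> D \<in> F}"

definition color_class :: "('a set \<Rightarrow> nat) \<Rightarrow> 'a graph \<Rightarrow> nat \<Rightarrow> 'a graph" where
  "color_class c G i = Graph (verts G) {e \<in> edges G. c e = i}"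

text \<open>Only the values of the coloring \<open>c\<close> on the edges of the complete graph matter. Since there are
  finitely many edges, natural numbers suffice as colors. Colors \<open>i\<close> that do not occur in the
  copy \<open>H\<close> give edgeless classes, which are members of every graph family.\<close>

definition color_number :: "nat \<Rightarrow> nat graph \<Rightarrow> nat graph set \<Rightarrow> nat" where
  "color_number n G F =
     (LEAST k. 0 < k \<and>
        (\<forall>c. k \<le> card (c ` edges (complete_graph n)) \<longrightarrow>
           (\<exists>H. subgraph H (complete_graph n) \<and> isomorphic G H \<and> (\<forall>i. color_class c H i \<in> F))))"

definition free_of :: "nat graph set \<Rightarrow> nat graph \<Rightarrow> bool" where
  "free_of \<H> G \<longleftrightarrow> \<not> (\<exists>H\<in>\<H>. \<exists>S. subgraph S G \<and> isomorphic H S)"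

text \<open>The set below is always finite; it is nonempty (so the maximum is meaningful) whenever
  all members of \<open>\<H>\<close> have an edge, as is the case for the deck of a graph outside a
  hereditary family.\<close>

definition ex_number :: "nat \<Rightarrow> nat graph set \<Rightarrow> nat" where
  "ex_number n \<H> =
     Max {card (edges G) | G. simple_graph G \<and> card (verts G) = n \<and> free_of \<H> G}"

end

theory Submission
  imports Defs
begin

text \<open>Take a graph \<open>E\<close> on the vertices of \<open>K\<^sub>n\<close> that has as many edges as possible without containing
  a member of the deck. Give the edges of \<open>E\<close> pairwise distinct colors and give all the other edges
  of \<open>K\<^sub>n\<close> one further color. Suppose that in some copy \<open>H\<close> of \<open>G\<close> every color class lies in \<open>F\<close>.
  Then the class \<open>D\<close> of the further color lies in \<open>F\<close>, so \<open>H - D\<close> is a copy of a deck member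
  (lemma \<open>delete_edges_copy_in_deck\<close>); but all edges of \<open>H - D\<close> belong to \<open>E\<close>, a contradiction. So
  this coloring has no such copy of \<open>G\<close>.

  It remains to count its colors. The graph \<open>G = G - \<emptyset>\<close> is in the deck and fits into \<open>K\<^sub>n\<close>, so \<open>E\<close> is
  not complete, the further color does occur, and there are exactly one more color than edges of
  \<open>E\<close>. Hence the threshold exceeds the extremal number by at least two.

  That the extremal number is attained at all (lemma \<open>ex_number_attained\<close>) rests on \<open>G \<notin> F\<close>: it
  forces every deck member to have an edge, so the edgeless graph competes for the maximum.\<close>

section \<open>Isomorphic images of graphs\<close>

definition image_graph :: "('a \<Rightarrow> 'b) \<Rightarrow> 'a graph \<Rightarrow> 'b graph" where
  "image_graph \<phi> G = Graph (\<phi> ` verts G) ((\<lambda>e. \<phi> ` e) ` edges G)"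

lemma image_graph_sel [simp]:
  "verts (image_graph \<phi> G) = \<phi> ` verts G"
  "edges (image_graph \<phi> G) = (\<lambda>e. \<phi> ` e) ` edges G"
  by (simp_all add: image_graph_def)

lemma delete_edges_sel [simp]:
  "verts (delete_edges G D) = verts G"
  "edges (delete_edges G D) = edges G - edges D"
  by (simp_all add: delete_edges_def)

lemma color_class_sel [simp]:
  "verts (color_class c G i) = verts G"
  "edges (color_class c G i) = {e \<in> edges G. c e = i}"
  by (simp_all add: color_class_def)

lemma complete_graph_sel [simp]:
  "verts (complete_graph n) = {..<n}"
  "edges (complete_graph n) = {e. e \<subseteq> {..<n} \<and> card e = 2}"
  by (simp_all add: complete_graph_def)

lemma simple_complete_graph: "simple_graph (complete_graph n)"
  by (simp add: simple_graph_def)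

lemma finite_edges: "simple_graph G \<Longrightarrow> finite (edges G)"
  unfolding simple_graph_def by (rule finite_subset[of _ "Pow (verts G)"]) auto

lemma inj_on_image_edges:
  assumes "simple_graph G" "inj_on \<phi> (verts G)"
  shows "inj_on (\<lambda>e. \<phi> ` e) (edges G)"
  using assms unfolding simple_graph_def inj_on_def[of "\<lambda>e. \<phi> ` e"]
  by (metis inj_on_image_eq_iff)

lemma simple_image_graph:
  assumes "simple_graph G" "inj_on \<phi> (verts G)"
  shows "simple_graph (image_graph \<phi> G)"
  using assms unfolding simple_graph_def
  by (auto simp: card_image inj_on_subset)

lemma isomorphic_iff_image_graph:
  "isomorphic G H \<longleftrightarrow> simple_graph G \<and> (\<exists>\<phi>. inj_on \<phi> (verts G) \<and> H = image_graph \<phi> G)"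
proof
  assume "isomorphic G H"
  then show "simple_graph G \<and> (\<exists>\<phi>. inj_on \<phi> (verts G) \<and> H = image_graph \<phi> G)"
    by (cases H) (auto simp: isomorphic_def bij_betw_def image_graph_def)
next
  assume "simple_graph G \<and> (\<exists>\<phi>. inj_on \<phi> (verts G) \<and> H = image_graph \<phi> G)"
  then show "isomorphic G H"
    unfolding isomorphic_def
    by (metis bij_betw_imageI image_graph_sel simple_image_graph)
qed

lemma isomorphic_image_graph:
  "simple_graph G \<Longrightarrow> inj_on \<phi> (verts G) \<Longrightarrow> isomorphic G (image_graph \<phi> G)"
  by (auto simp: isomorphic_iff_image_graph)

lemma image_graph_inv_into:
  assumes "simple_graph G" "inj_on \<phi> (verts G)"
  shows "image_graph (inv_into (verts G) \<phi>) (image_graph \<phi> G) = G"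
proof -
  have "inv_into (verts G) \<phi> ` \<phi> ` e = e" if "e \<in> edges G" for e
    using that assms by (intro inv_into_image_cancel) (auto simp: simple_graph_def)
  moreover have "inv_into (verts G) \<phi> ` \<phi> ` verts G = verts G"
    using assms by (intro inv_into_image_cancel) auto
  ultimately show ?thesis
    by (cases G) (simp add: image_graph_def image_image)
qed

lemma isomorphic_sym:
  assumes "isomorphic G H"
  shows "isomorphic H G"
proof -
  obtain \<phi> where "simple_graph G" "inj_on \<phi> (verts G)" "H = image_graph \<phi> G"
    using assms by (auto simp: isomorphic_iff_image_graph)
  then show ?thesis
    using isomorphic_image_graph[of H "inv_into (verts G) \<phi>"]
    by (simp add: image_graph_inv_into simple_image_graph inj_on_inv_into)
qed

lemma isomorphic_trans:
  assumes "isomorphic G H" "isomorphic H K"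
  shows "isomorphic G K"
proof -
  obtain \<phi> \<psi> where \<phi>: "simple_graph G" "inj_on \<phi> (verts G)" "H = image_graph \<phi> G"
    and \<psi>: "inj_on \<psi> (verts H)" "K = image_graph \<psi> H"
    using assms by (auto simp: isomorphic_iff_image_graph)
  have "K = image_graph (\<psi> \<circ> \<phi>) G"
    using \<phi> \<psi> by (simp add: image_graph_def image_image image_comp)
  then show ?thesis
    using \<phi> \<psi> comp_inj_on[of \<phi> "verts G" \<psi>] by (auto simp: isomorphic_iff_image_graph)
qed

lemma subgraph_image_graph:
  assumes "subgraph S G" "inj_on \<phi> (verts G)"
  shows "subgraph (image_graph \<phi> S) (image_graph \<phi> G)" "isomorphic S (image_graph \<phi> S)"
  using assms inj_on_subset[of \<phi> "verts G" "verts S"]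
  unfolding subgraph_def
  by (auto intro!: simple_image_graph isomorphic_image_graph simp: image_mono)

lemma free_of_isomorphic:
  assumes "free_of \<H> G" "isomorphic G G'"
  shows "free_of \<H> G'"
  unfolding free_of_def
proof
  assume "\<exists>H\<in>\<H>. \<exists>S. subgraph S G' \<and> isomorphic H S"
  then obtain H S where S: "H \<in> \<H>" "subgraph S G'" "isomorphic H S" by blast
  obtain \<phi> where "inj_on \<phi> (verts G')" "G = image_graph \<phi> G'"
    using isomorphic_sym[OF assms(2)] by (auto simp: isomorphic_iff_image_graph)
  then have "subgraph (image_graph \<phi> S) G" "isomorphic H (image_graph \<phi> S)"
    using subgraph_image_graph[OF S(2)] isomorphic_trans[OF S(3)] by auto
  with S(1) assms(1) show False by (auto simp: free_of_def)
qed

lemma isomorphic_on_initial_segment: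
  fixes G :: "'a graph"
  assumes "simple_graph G"
  obtains G' where "isomorphic G G'" "verts G' = {..<card (verts G)}"
    "card (edges G') = card (edges G)"
proof -
  have "finite (verts G)" using assms by (simp add: simple_graph_def)
  then obtain \<phi> where \<phi>: "bij_betw \<phi> (verts G) {..<card (verts G)}"
    using ex_bij_betw_finite_nat[of "verts G"] by (auto simp: atLeast0LessThan)
  then have inj: "inj_on \<phi> (verts G)" and im: "\<phi> ` verts G = {..<card (verts G)}"
    by (auto simp: bij_betw_def)
  show ?thesis
  proof (rule that)
    show "isomorphic G (image_graph \<phi> G)"
      using assms inj by (rule isomorphic_image_graph)
    show "verts (image_graph \<phi> G) = {..<card (verts G)}"
      using im by simp
    show "card (edges (image_graph \<phi> G)) = card (edges G)"
      by (simp add: card_image inj_on_image_edges[OF assms inj])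
  qed
qed

section \<open>The deck\<close>

text \<open>Membership in \<open>F\<close> is invariant under isomorphism, so pulling the deleted part back along an
  isomorphism turns a deletion from a copy of \<open>G\<close> into a deletion from \<open>G\<close> itself.\<close>

lemma delete_edges_copy_in_deck:
  assumes "graph_family F" "isomorphic G H" "subgraph D H" "D \<in> F"
  shows "\<exists>K\<in>deck G F. isomorphic K (delete_edges H D)"
proof -
  have simple: "simple_graph H" and iso: "isomorphic H G"
    using assms(3) isomorphic_sym[OF assms(2)] by (auto simp: subgraph_def)
  then obtain \<psi> where inj: "inj_on \<psi> (verts H)" and G: "G = image_graph \<psi> H"
    by (auto simp: isomorphic_iff_image_graph)
  let ?D = "image_graph \<psi> D"
  have D: "subgraph ?D G" "isomorphic D ?D"
    using subgraph_image_graph[OF assms(3) inj] G by auto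
  then have "?D \<in> F"
    using assms(1,4) unfolding graph_family_def by blast
  with D(1) have in_deck: "delete_edges G ?D \<in> deck G F"
    by (auto simp: deck_def)
  have "(\<lambda>e. \<psi> ` e) ` (edges H - edges D) = edges G - edges ?D"
    using inj_on_image_set_diff[OF inj_on_image_edges[OF simple inj], of "edges H" "edges D"]
      assms(3) G by (auto simp: subgraph_def)
  then have "image_graph \<psi> (delete_edges H D) = delete_edges G ?D"
    by (simp add: image_graph_def delete_edges_def G)
  moreover have "simple_graph (delete_edges H D)"
    using simple by (simp add: simple_graph_def)
  ultimately have "isomorphic (delete_edges H D) (delete_edges G ?D)"
    using inj isomorphic_image_graph[of "delete_edges H D" \<psi>] by simp
  with in_deck show ?thesis
    using isomorphic_sym by blast
qed

lemma self_in_deck: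
  assumes "graph_family F" "simple_graph G"
  shows "G \<in> deck G F"
proof -
  have "subgraph (Graph (verts G) {}) G"
    using assms(2) by (auto simp: subgraph_def simple_graph_def)
  moreover have "Graph (verts G) {} \<in> F"
  proof -
    have "simple_graph (Graph (verts G) {})" "edges (Graph (verts G) {}) = {}"
      using assms(2) by (simp_all add: simple_graph_def)
    with assms(1) show ?thesis
      unfolding graph_family_def by blast
  qed
  moreover have "G = delete_edges G (Graph (verts G) {})"
    by (cases G) (simp add: delete_edges_def)
  ultimately show ?thesis
    unfolding deck_def by (intro CollectI exI conjI)
qed

text \<open>Deleting a member of \<open>F\<close> with the same edge set as \<open>G\<close> would put \<open>G\<close> itself into \<open>F\<close>, since
  isolated vertices do not affect membership.\<close>

lemma deck_member_has_edge:
  assumes "graph_family F" "simple_graph G" "G \<notin> F" "K \<in> deck G F"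
  shows "edges K \<noteq> {}"
proof
  assume "edges K = {}"
  then obtain D where "subgraph D G" "D \<in> F" "edges G - edges D = {}"
    using assms(4) by (auto simp: deck_def)
  then have "edges D = edges G" "simple_graph D" "D \<in> F"
    by (auto simp: subgraph_def)
  with assms(1-3) show False
    unfolding graph_family_def by blast
qed

section \<open>Extremal graphs and colorings of complete graphs\<close>

text \<open>An extremal graph may have any \<open>n\<close> naturals as vertices. Renaming them to the vertices of \<open>K\<^sub>n\<close>
  keeps the number of edges and, by \<open>free_of_isomorphic\<close>, the freeness.\<close>

lemma ex_number_attained:
  assumes "\<And>K. K \<in> \<H> \<Longrightarrow> edges K \<noteq> {}"
  obtains E where "simple_graph E" "verts E = {..<n}" "free_of \<H> E"
    "card (edges E) = ex_number n \<H>"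
proof -
  let ?M = "{card (edges G) | G. simple_graph G \<and> card (verts G) = n \<and> free_of \<H> G}"
  have "card (edges G) \<le> 2 ^ n" if "simple_graph G" "card (verts G) = n" for G :: "nat graph"
  proof -
    have "card (edges G) \<le> card (Pow (verts G))"
      using that by (intro card_mono) (auto simp: simple_graph_def)
    then show ?thesis
      using that by (simp add: card_Pow simple_graph_def)
  qed
  then have "finite ?M"
    by (intro finite_subset[of ?M "{..2 ^ n}"]) auto
  moreover have "?M \<noteq> {}"
  proof -
    let ?E = "Graph {..<n} {}"
    have "simple_graph ?E" "card (verts ?E) = n"
      by (auto simp: simple_graph_def)
    moreover have "free_of \<H> ?E"
      using assms by (auto simp: free_of_def subgraph_def isomorphic_def)
    ultimately show ?thesis by blast
  qed
  ultimately have "ex_number n \<H> \<in> ?M"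
    unfolding ex_number_def by (rule Max_in)
  then obtain E where E: "simple_graph E" "card (verts E) = n" "free_of \<H> E"
    "ex_number n \<H> = card (edges E)" by blast
  obtain E' where "isomorphic E E'" "verts E' = {..<n}" "card (edges E') = card (edges E)"
    using isomorphic_on_initial_segment[OF E(1)] E(2) by metis
  with E free_of_isomorphic show ?thesis
    by (intro that[of E']) (auto simp: isomorphic_def)
qed

lemma copy_in_complete_graph:
  assumes "simple_graph G" "card (verts G) \<le> n"
  shows "\<exists>S. subgraph S (complete_graph n) \<and> isomorphic G S"
proof -
  obtain S where S: "isomorphic G S" "verts S = {..<card (verts G)}"
    using isomorphic_on_initial_segment[OF assms(1)] .
  then have simple: "simple_graph S" by (simp add: isomorphic_def)
  have "verts S \<subseteq> {..<n}" using S(2) assms(2) by auto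
  then have "subgraph S (complete_graph n)"
    using simple simple_complete_graph by (auto simp: subgraph_def simple_graph_def)
  with S(1) show ?thesis by blast
qed

text \<open>Colorings with fewer colors than the threshold are what bounds it from below. As a least
  element the threshold is meaningful because with more colors than edges the requirement is
  vacuous.\<close>

lemma color_number_greater:
  assumes "\<nexists>H. subgraph H (complete_graph n) \<and> isomorphic G H \<and> (\<forall>i. color_class c H i \<in> F)"
  shows "card (c ` edges (complete_graph n)) < color_number n G F"
proof -
  let ?good = "\<lambda>c. \<exists>H. subgraph H (complete_graph n) \<and> isomorphic G H \<and>
    (\<forall>i. color_class c H i \<in> F)"
  let ?P = "\<lambda>k. 0 < k \<and> (\<forall>c :: nat set \<Rightarrow> nat.
    k \<le> card (c ` edges (complete_graph n)) \<longrightarrow> ?good c)"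
  have "?P (Suc (card (edges (complete_graph n))))"
    using card_image_le[OF finite_edges[OF simple_complete_graph, of n]]
    by (auto simp: Suc_le_eq simp del: complete_graph_sel dest: leD)
  then have "?P (color_number n G F)"
    unfolding color_number_def by (rule LeastI)
  with assms show ?thesis
    by (meson not_less)
qed

section \<open>The lower bound\<close>

theorem theorem2p3:
  fixes F :: "nat graph set" and G :: "nat graph" and n :: nat
  assumes "hereditary F"
    and "complete_graph 2 \<in> F"
    and "simple_graph G"
    and "G \<notin> F"
    and "n \<ge> card (verts G)"
  shows "color_number n G F \<ge> ex_number n (deck G F) + 2"
proof -
  have fam: "graph_family F"
    using assms(1) by (simp add: hereditary_def)
  obtain E where E: "simple_graph E" "verts E = {..<n}" "free_of (deck G F) E"
    "card (edges E) = ex_number n (deck G F)"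
    using ex_number_attained deck_member_has_edge[OF fam assms(3,4)] by metis
  let ?K = "edges (complete_graph n)"
  have sub: "edges E \<subseteq> ?K"
    using E(1,2) by (auto simp: simple_graph_def)
  have "edges E \<noteq> ?K"
  proof
    assume "edges E = ?K"
    with E(2) have "E = complete_graph n"
      by (cases E) (simp add: complete_graph_def)
    with E(3) show False
      using copy_in_complete_graph[OF assms(3,5)] self_in_deck[OF fam assms(3)]
      unfolding free_of_def by blast
  qed
  with sub obtain e0 where e0: "e0 \<in> ?K" "e0 \<notin> edges E" by blast
  have "finite (edges E)" using E(1) by (rule finite_edges)
  then obtain idx :: "nat set \<Rightarrow> nat" where idx: "inj_on idx (edges E)"
    using finite_imp_inj_to_nat_seg by blast
  \<comment> \<open>The successor reserves color 0 for the edges outside \<open>E\<close>.\<close>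
  define c where "c e = (if e \<in> edges E then Suc (idx e) else 0)" for e
  have colors: "c ` ?K = insert 0 (c ` edges E)"
    using sub e0 by (auto simp: c_def simp del: complete_graph_sel)
  have "inj_on c (edges E)" "0 \<notin> c ` edges E"
    using idx by (auto simp: inj_on_def c_def)
  then have "card (c ` ?K) = ex_number n (deck G F) + 1"
    using E(4) \<open>finite (edges E)\<close> by (simp add: colors card_image del: complete_graph_sel)
  moreover have "card (c ` ?K) < color_number n G F"
  proof (rule color_number_greater, clarify)
    fix H
    assume H: "subgraph H (complete_graph n)" "isomorphic G H" "\<forall>i. color_class c H i \<in> F"
    let ?D = "color_class c H 0"
    have "subgraph ?D H"
      using H(1) by (auto simp: subgraph_def simple_graph_def)
    then obtain K where K: "K \<in> deck G F" "isomorphic K (delete_edges H ?D)"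
      using delete_edges_copy_in_deck[OF fam H(2)] H(3) by blast
    moreover have "subgraph (delete_edges H ?D) E"
      using H(1) E(1,2) by (auto simp: subgraph_def simple_graph_def c_def split: if_splits)
    ultimately show False
      using E(3) unfolding free_of_def by blast
  qed
  ultimately show ?thesis by simp
qed

end
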